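(* Let $(z,w)$, $w=u+iv$, be the standard complex coordinates on $\mathbb{C}^2$ and let $g$ be the Kähler metric on $\mathbb{C}^2$ with coefficient matrix $$g=\begin{pmatrix}4e^u & 2\bar z e^u\\[0.5em] 2ze^u & |z|^2e^u+\frac14 e^{-u}\end{pmatrix}.$$ Let $t\mapsto (z(t),w(t))$, $w(t)=u(t)+iv(t)$, $t\ge 0$, be the maximal (forward in time) geodesic of $g$ with starting point $(z_0,w_0)\in\mathbb{C}^2$, $w_0=u_0+iv_0$, and initial velocity $(Z,W)\in\mathbb{C}^2$, $W=U+iV$. Then, for all $t\ge 0$ in the interval of existence, $$u(t)=u_0-\log\left(\frac{U^2+V^2}{4}t^2-Ut+1\right),$$ $$v(t)=\begin{cases}v_0+2\arctan\left(\dfrac{U}{V}\right)-2\arctan\left(\dfrac{U-\frac{U^2+V^2}{2}t}{V}\right), & V\neq 0,\\[1em] v_0, & V=0,\end{cases}$$ $$z(t)=\left[1-\frac{W}{2}t\right]\left[z_0+\left(Z+\frac{z_0W}{2}\right)t\right].$$ If $U\le 0$ or $V\neq 0$, the geodesic is defined for all $t\ge 0$. If $U>0$ and $V=0$, it is defined exactly for $0\le t<2/U$, and $u(t)\to+\infty$ as $t\to 2/U$.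
   Context: The metric $g$ (Warren's metric) is the complex Hessian of $f(z,w)=4|z|^2e^{\operatorname{Re}(w)}+e^{-\operatorname{Re}(w)}$: its entries are $g_{\alpha\bar\beta}=\partial^2 f/\partial z_\alpha\partial\bar z_\beta$ with $(z_1,z_2)=(z,w)$. Geodesics are those of the Levi-Civita connection of the associated Riemannian metric. Tangent vectors are identified with elements $(Z,W)\in\mathbb{C}^2$ via $Z=\frac{dz}{dt}(0)$, $W=\frac{dw}{dt}(0)$. The function $\arctan$ takes values in $(-\pi/2,\pi/2)$. *)

theory Defs
  imports "HOL-Analysis.Analysis"
begin

(* A Riemannian metric on the whole of a Euclidean space 'a is a map G, where G p X Y is the
   inner product of the tangent vectors X, Y at p; all tangent spaces are identified with 'a.
   Vector fields are maps 'a => 'a. *)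

(* Relative to the global flat coordinates, every affine connection is the directional
   derivative plus a bilinear form Gam p on tangent vectors (its Christoffel symbols). *)
definition covariant_deriv ::
    "('a::euclidean_space \<Rightarrow> 'a \<Rightarrow> 'a \<Rightarrow> 'a) \<Rightarrow> ('a \<Rightarrow> 'a) \<Rightarrow> ('a \<Rightarrow> 'a) \<Rightarrow> 'a \<Rightarrow> 'a" where
  "covariant_deriv Gam X Y p = frechet_derivative Y (at p) (X p) + Gam p (X p) (Y p)"

definition lie_bracket :: "('a::euclidean_space \<Rightarrow> 'a) \<Rightarrow> ('a \<Rightarrow> 'a) \<Rightarrow> 'a \<Rightarrow> 'a" where
  "lie_bracket X Y p = frechet_derivative Y (at p) (X p) - frechet_derivative X (at p) (Y p)"

definition torsion_free :: "('a::euclidean_space \<Rightarrow> 'a \<Rightarrow> 'a \<Rightarrow> 'a) \<Rightarrow> bool" where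
  "torsion_free Gam \<longleftrightarrow>
     (\<forall>X Y p. X differentiable_on UNIV \<and> Y differentiable_on UNIV \<longrightarrow>
        covariant_deriv Gam X Y p - covariant_deriv Gam Y X p = lie_bracket X Y p)"

definition metric_compatible ::
    "('a::euclidean_space \<Rightarrow> 'a \<Rightarrow> 'a \<Rightarrow> real) \<Rightarrow> ('a \<Rightarrow> 'a \<Rightarrow> 'a \<Rightarrow> 'a) \<Rightarrow> bool" where
  "metric_compatible G Gam \<longleftrightarrow>
     (\<forall>X Y Z p. X differentiable_on UNIV \<and> Y differentiable_on UNIV \<and> Z differentiable_on UNIV \<longrightarrow>
        frechet_derivative (\<lambda>q. G q (Y q) (Z q)) (at p) (X p) =
          G p (covariant_deriv Gam X Y p) (Z p) + G p (Y p) (covariant_deriv Gam X Z p))"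

definition is_levi_civita ::
    "('a::euclidean_space \<Rightarrow> 'a \<Rightarrow> 'a \<Rightarrow> real) \<Rightarrow> ('a \<Rightarrow> 'a \<Rightarrow> 'a \<Rightarrow> 'a) \<Rightarrow> bool" where
  "is_levi_civita G Gam \<longleftrightarrow>
     (\<forall>p. bilinear (Gam p)) \<and> torsion_free Gam \<and> metric_compatible G Gam"

(* Uniquely determined for a differentiable Riemannian metric (fundamental theorem of
   Riemannian geometry). *)
definition levi_civita ::
    "('a::euclidean_space \<Rightarrow> 'a \<Rightarrow> 'a \<Rightarrow> real) \<Rightarrow> 'a \<Rightarrow> 'a \<Rightarrow> 'a \<Rightarrow> 'a" where
  "levi_civita G = (THE Gam. is_levi_civita G Gam)"

(* The second conjunct is the vanishing of the covariant derivative of the velocity vel along c.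
   Derivatives are within I, hence one-sided at end points belonging to I. *)
definition geodesic_on ::
    "('a::euclidean_space \<Rightarrow> 'a \<Rightarrow> 'a \<Rightarrow> real) \<Rightarrow> real set \<Rightarrow> (real \<Rightarrow> 'a) \<Rightarrow> (real \<Rightarrow> 'a) \<Rightarrow> bool" where
  "geodesic_on G I c vel \<longleftrightarrow>
     (\<forall>t\<in>I. (c has_vector_derivative vel t) (at t within I) \<and>
            (vel has_vector_derivative - levi_civita G (c t) (vel t) (vel t)) (at t within I))"

definition forward_interval :: "real set \<Rightarrow> bool" where
  "forward_interval I \<longleftrightarrow> is_interval I \<and> I \<subseteq> {0..} \<and> 0 \<in> I \<and> I \<noteq> {0}"

definition forward_geodesic ::
    "('a::euclidean_space \<Rightarrow> 'a \<Rightarrow> 'a \<Rightarrow> real) \<Rightarrow> 'a \<Rightarrow> 'a \<Rightarrow> real set \<Rightarrow> (real \<Rightarrow> 'a) \<Rightarrow> bool" where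
  "forward_geodesic G p0 v0 I c \<longleftrightarrow>
     forward_interval I \<and> c 0 = p0 \<and> (\<exists>vel. vel 0 = v0 \<and> geodesic_on G I c vel)"

(* Only the values of c on I matter. *)
definition maximal_forward_geodesic ::
    "('a::euclidean_space \<Rightarrow> 'a \<Rightarrow> 'a \<Rightarrow> real) \<Rightarrow> 'a \<Rightarrow> 'a \<Rightarrow> real set \<Rightarrow> (real \<Rightarrow> 'a) \<Rightarrow> bool" where
  "maximal_forward_geodesic G p0 v0 I c \<longleftrightarrow>
     forward_geodesic G p0 v0 I c \<and>
     (\<forall>J d. forward_geodesic G p0 v0 J d \<and> I \<subseteq> J \<and> (\<forall>t\<in>I. d t = c t) \<longrightarrow> J = I)"

(* H p $ a $ b is the coefficient of dz_a (x) dzbar_b. Whether one takes Re or 2 Re as the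
   associated Riemannian metric is irrelevant here: constant multiples of a metric have the
   same Levi-Civita connection. *)
definition associated_riemannian ::
    "(complex^'n \<Rightarrow> complex^'n^'n) \<Rightarrow> complex^'n \<Rightarrow> complex^'n \<Rightarrow> complex^'n \<Rightarrow> real" where
  "associated_riemannian H p X Y = Re (\<Sum>a\<in>UNIV. \<Sum>b\<in>UNIV. H p $ a $ b * X $ a * cnj (Y $ b))"

(* The complex Hessian of 4 |z|^2 exp (Re w) + exp (- Re w), where z = p $ 1 and w = p $ 2. *)
definition warren_metric :: "complex^2 \<Rightarrow> complex^2^2" where
  "warren_metric p =
     (let z = p $ 1; u = Re (p $ 2) in
      vector [vector [of_real (4 * exp u), 2 * cnj z * of_real (exp u)],
              vector [2 * z * of_real (exp u),
                      of_real ((cmod z)\<^sup>2 * exp u + exp (- u) / 4)]])"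

end

theory Submission imports Defs
begin

text \<open>
  The metric is $e^u |2\,dz + z\,dw|^2 + \frac14 e^{-u} |dw|^2$, and its geodesic equation is
  $w'' = w'^2/2$, $z'' = -z'w' - z w'^2/2$. Both $e^{-w/2}$ and $z e^{w/2}$ have vanishing second
  derivative along solutions, so $e^{-w/2} = e^{-w_0/2} (1 - Wt/2)$; the modulus of this identity
  gives $u$. Conversely $w = w_0 - 2 \log(1 - Wt/2)$ is a solution as long as $1 - Wt/2$ stays off
  the nonpositive real axis, which fails only for $V = 0 < U$, at $t = 2/U$; there $e^{-u}$ vanishes.
\<close>

section \<open>Uniqueness of the Levi-Civita connection\<close>

text \<open>The uniqueness half of the fundamental theorem of Riemannian geometry. It lets the
  \<open>THE\<close> in \<open>levi_civita\<close> be evaluated as soon as one candidate is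
  verified. The difference of two candidates is symmetric by vanishing torsion and skew by
  compatibility.\<close>

lemma is_levi_civita_unique:
  fixes G :: "'a::euclidean_space \<Rightarrow> 'a \<Rightarrow> 'a \<Rightarrow> real"
  assumes bil: "\<And>p. bilinear (G p)" and sym: "\<And>p x y. G p x y = G p y x"
    and nondeg: "\<And>p x. G p x x = 0 \<Longrightarrow> x = 0"
    and G1: "is_levi_civita G Gam1" and G2: "is_levi_civita G Gam2"
  shows "Gam1 = Gam2"
proof (intro ext)
  fix p x y
  \<comment> \<open>Constant fields suffice as test fields: their derivatives and Lie brackets
    vanish, so torsion-freeness becomes symmetry of \<open>Gam p\<close>, and compatibility below
    only involves the derivative of \<open>G\<close>.\<close>
  have symm: "Gam p a b = Gam p b a" if "is_levi_civita G Gam" for Gam a b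
  proof -
    have "covariant_deriv Gam (\<lambda>_. a) (\<lambda>_. b) p - covariant_deriv Gam (\<lambda>_. b) (\<lambda>_. a) p
        = lie_bracket (\<lambda>_. a) (\<lambda>_. b) p"
      using that unfolding is_levi_civita_def torsion_free_def by simp
    then show ?thesis
      by (simp add: covariant_deriv_def lie_bracket_def)
  qed
  have compat: "frechet_derivative (\<lambda>q. G q b c) (at p) a = G p (Gam p a b) c + G p b (Gam p a c)"
    if "is_levi_civita G Gam" for Gam a b c
  proof -
    have "metric_compatible G Gam"
      using that unfolding is_levi_civita_def by simp
    from this[unfolded metric_compatible_def, rule_format, of "\<lambda>_. a" "\<lambda>_. b" "\<lambda>_. c" p]
    show ?thesis
      by (simp add: covariant_deriv_def)
  qed
  define D where "D a b = Gam1 p a b - Gam2 p a b" for a b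
  have Dsym: "G p (D a b) c = G p (D b a) c" for a b c
    unfolding D_def using symm[OF G1, of a b] symm[OF G2, of a b] by simp
  have Dskew: "G p (D a b) c = - G p (D a c) b" for a b c
    unfolding D_def using compat[OF G1, of b c a] compat[OF G2, of b c a]
    by (simp add: bilinear_lsub[OF bil] sym[of p b])
  \<comment> \<open>A trilinear form symmetric in its first two and skew in its last two arguments vanishes.\<close>
  have "G p (D a b) c = 0" for a b c
    using Dsym[of a b c] Dskew[of b a c] Dsym[of b c a] Dskew[of c b a] Dsym[of c a b] Dskew[of a c b]
    by simp
  then have "D x y = 0"
    using nondeg by blast
  then show "Gam1 p x y = Gam2 p x y"
    by (simp add: D_def)
qed

section \<open>The Levi-Civita connection of Warren's metric\<close>

text \<open>In complex coordinates the nonzero Christoffel symbols are Gamma^1_12 = Gamma^1_21 =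
  1/2, Gamma^1_22 = z/2 and Gamma^2_22 = -1/2. As for every Kaehler metric, the symbols with mixed
  indices vanish, so the form is complex bilinear.\<close>

definition warren_christoffel :: "complex^2 \<Rightarrow> complex^2 \<Rightarrow> complex^2 \<Rightarrow> complex^2" where
  "warren_christoffel p X Y =
     vector [(X $ 1 * Y $ 2 + X $ 2 * Y $ 1) / 2 + p $ 1 * X $ 2 * Y $ 2 / 2, - (X $ 2 * Y $ 2) / 2]"

text \<open>Completing the square: the coframe 2 dz + z dw, dw is orthogonal for the metric.
  Definiteness can be read off from this form, and the compatibility check splits into two scalar
  terms.\<close>

lemma warren_metric_eq:
  "associated_riemannian warren_metric p X Y =
     exp (Re (p $ 2)) * ((2 * X $ 1 + p $ 1 * X $ 2) \<bullet> (2 * Y $ 1 + p $ 1 * Y $ 2))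
     + exp (- Re (p $ 2)) / 4 * (X $ 2 \<bullet> Y $ 2)"
  unfolding associated_riemannian_def warren_metric_def Let_def
  unfolding cmod_power2
  by (simp add: sum_2 inner_complex_def algebra_simps power2_eq_square)

lemma warren_metric_bilinear: "bilinear (associated_riemannian warren_metric p)"
  unfolding bilinear_def
  by (intro conjI allI linearI)
     (simp_all add: warren_metric_eq inner_complex_def algebra_simps)

lemma warren_metric_definite:
  assumes "associated_riemannian warren_metric p X X = 0"
  shows "X = 0"
proof -
  have "exp (Re (p $ 2)) * ((2 * X $ 1 + p $ 1 * X $ 2) \<bullet> (2 * X $ 1 + p $ 1 * X $ 2)) = 0"
    "exp (- Re (p $ 2)) / 4 * (X $ 2 \<bullet> X $ 2) = 0"
    using assms unfolding warren_metric_eq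
    by (subst (asm) add_nonneg_eq_0_iff; simp)+
  then have "X $ 1 = 0 \<and> X $ 2 = 0"
    by auto
  then show ?thesis
    by (simp add: vec_eq_iff forall_2)
qed

lemma bilinear_warren_christoffel: "bilinear (warren_christoffel p)"
  unfolding bilinear_def
  by (intro conjI allI linearI)
     (simp_all add: warren_christoffel_def vec_eq_iff forall_2 field_simps
        scaleR_conv_of_real[where 'a = complex])

text \<open>The connection is diagonal in the coframe 2 dz + z dw, dw: on the two components of a
  field, the covariant derivative along \<open>X\<close> is the plain derivative plus, respectively
  minus, X_2/2 times the component (\<open>cov1\<close>, \<open>cov2\<close>). The real parts of
  these scalars are half the logarithmic derivatives of the weights e^u and e^(-u), exactly what
  compatibility asks for.\<close>

lemma metric_compatible_warren:
  "metric_compatible (associated_riemannian warren_metric) warren_christoffel"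
  unfolding metric_compatible_def
proof (intro allI impI, elim conjE)
  fix X Y Z :: "complex^2 \<Rightarrow> complex^2" and p :: "complex^2"
  assume "Y differentiable_on UNIV" "Z differentiable_on UNIV"
  then have "Y differentiable (at p)" "Z differentiable (at p)"
    by (auto simp: differentiable_on_def)
  then have Y: "(Y has_derivative frechet_derivative Y (at p)) (at p)"
    and Z: "(Z has_derivative frechet_derivative Z (at p)) (at p)"
    by (auto simp: frechet_derivative_works)
  note vec_nth = bounded_linear.has_derivative[OF bounded_linear_vec_nth]
  let ?G = "\<lambda>q. associated_riemannian warren_metric q (Y q) (Z q)"
  let ?th = "\<lambda>q v. 2 * v $ 1 + q $ 1 * v $ 2"
  have u: "((\<lambda>q::complex^2. Re (q $ 2)) has_derivative (\<lambda>h. Re (h $ 2))) (at p)"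
    by (intro bounded_linear.has_derivative[OF bounded_linear_Re] vec_nth has_derivative_ident)
  have E: "((\<lambda>q::complex^2. exp (Re (q $ 2))) has_derivative
      (\<lambda>h. exp (Re (p $ 2)) * Re (h $ 2))) (at p)"
    by (rule has_derivative_eq_rhs[OF has_derivative_exp[OF u]]) (simp add: mult.commute)
  have E': "((\<lambda>q::complex^2. exp (- Re (q $ 2)) / 4) has_derivative
      (\<lambda>h. - exp (- Re (p $ 2)) / 4 * Re (h $ 2))) (at p)"
    by (rule has_derivative_eq_rhs[OF has_derivative_divide'[OF has_derivative_exp[OF has_derivative_minus[OF u]] has_derivative_const]])
       (auto simp: fun_eq_iff)
  have th: "((\<lambda>q. ?th q (F q)) has_derivative (\<lambda>h. ?th p (F' h) + h $ 1 * F p $ 2)) (at p)"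
    if "(F has_derivative F') (at p)" for F F' :: "complex^2 \<Rightarrow> complex^2"
    by (rule has_derivative_eq_rhs[OF has_derivative_add[OF
            has_derivative_mult[OF has_derivative_const vec_nth[OF that]]
            has_derivative_mult[OF vec_nth[OF has_derivative_ident] vec_nth[OF that]]]]) auto
  note D = has_derivative_add[OF has_derivative_mult[OF E has_derivative_inner[OF th[OF Y] th[OF Z]]]
      has_derivative_mult[OF E' has_derivative_inner[OF vec_nth[OF Y, of 2] vec_nth[OF Z, of 2]]],
      folded warren_metric_eq]
  let ?cov = "covariant_deriv warren_christoffel X"
  have cov1: "?th p (?cov F p) = (?th p (frechet_derivative F (at p) (X p)) + X p $ 1 * F p $ 2)
      + X p $ 2 * ?th p (F p) / 2" for F
    by (simp add: covariant_deriv_def warren_christoffel_def field_simps)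
  have cov2: "?cov F p $ 2 = frechet_derivative F (at p) (X p) $ 2 - X p $ 2 * F p $ 2 / 2" for F
    by (simp add: covariant_deriv_def warren_christoffel_def)
  \<comment> \<open>The factor \<open>Re x\<close> arises because multiplying first one and then the
    other argument of the real inner product on the complex numbers by \<open>x / 2\<close>, and
    adding, gives \<open>Re x\<close> times the inner product.\<close>
  have split: "e * ((b + x * a / 2) \<bullet> c) + e' / 4 * ((b' - x * a' / 2) \<bullet> c') +
      (e * (a \<bullet> (d + x * c / 2)) + e' / 4 * (a' \<bullet> (d' - x * c' / 2))) =
      e * (a \<bullet> d + b \<bullet> c) + e * Re x * (a \<bullet> c) +
      (e' / 4 * (a' \<bullet> d' + b' \<bullet> c') + - e' / 4 * Re x * (a' \<bullet> c'))"
    for a b c d a' b' c' d' x :: complex and e e' :: real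
    by (simp add: inner_complex_def field_simps)
  show "frechet_derivative ?G (at p) (X p) =
      associated_riemannian warren_metric p (?cov Y p) (Z p) +
      associated_riemannian warren_metric p (Y p) (?cov Z p)"
    unfolding frechet_derivative_at[OF D, symmetric]
    unfolding warren_metric_eq unfolding cov1 unfolding cov2 unfolding split ..
qed

lemma levi_civita_warren:
  "levi_civita (associated_riemannian warren_metric) = warren_christoffel"
proof -
  have "torsion_free warren_christoffel"
    by (simp add: torsion_free_def covariant_deriv_def lie_bracket_def warren_christoffel_def
        algebra_simps)
  then have "is_levi_civita (associated_riemannian warren_metric) warren_christoffel"
    by (simp add: is_levi_civita_def bilinear_warren_christoffel metric_compatible_warren)
  moreover have "associated_riemannian warren_metric p x y = associated_riemannian warren_metric p y x"
    for p x y
    by (simp add: warren_metric_eq inner_commute)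
  ultimately show ?thesis
    unfolding levi_civita_def
    by (intro the_equality)
       (auto intro: is_levi_civita_unique warren_metric_bilinear warren_metric_definite)
qed

section \<open>The geodesic equation in coordinates, and tools for integrating it\<close>

lemma has_vector_derivative_vec_nth_iff:
  fixes f :: "real \<Rightarrow> ('a::euclidean_space)^'n"
  shows "(f has_vector_derivative f') (at t within S) \<longleftrightarrow>
     (\<forall>i. ((\<lambda>t. f t $ i) has_vector_derivative f' $ i) (at t within S))"
  unfolding has_vector_derivative_def
  by (subst has_derivative_componentwise_within)
     (auto simp: Basis_vec_def inner_axis has_derivative_componentwise_within[of "\<lambda>t. f t $ _"])

lemma geodesic_on_warren_iff:
  "geodesic_on (associated_riemannian warren_metric) I (\<lambda>t. vector [z t, w t]) vel \<longleftrightarrow>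
     (\<forall>t\<in>I. (z has_vector_derivative vel t $ 1) (at t within I) \<and>
       (w has_vector_derivative vel t $ 2) (at t within I) \<and>
       ((\<lambda>t. vel t $ 1) has_vector_derivative
          - (vel t $ 1 * vel t $ 2) - z t * (vel t $ 2)\<^sup>2 / 2) (at t within I) \<and>
       ((\<lambda>t. vel t $ 2) has_vector_derivative (vel t $ 2)\<^sup>2 / 2) (at t within I))"
proof -
  have "- warren_christoffel p X X = vector [- (X $ 1 * X $ 2) - p $ 1 * (X $ 2)\<^sup>2 / 2, (X $ 2)\<^sup>2 / 2]"
    for p X
    by (simp add: warren_christoffel_def vec_eq_iff forall_2 power2_eq_square field_simps)
  then show ?thesis
    by (simp add: geodesic_on_def levi_civita_warren has_vector_derivative_vec_nth_iff forall_2)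
qed

text \<open>Subtracting the linear function leaves a function with zero derivative on a convex set.
  Used with \<open>a = 0\<close> for first integrals and with general \<open>a\<close> for
  quantities that are affine along a geodesic.\<close>

lemma has_vector_derivative_const_imp_affine:
  fixes f :: "real \<Rightarrow> 'a::real_normed_vector"
  assumes "convex I" "0 \<in> I" "t \<in> I"
    and f: "\<And>t. t \<in> I \<Longrightarrow> (f has_vector_derivative a) (at t within I)"
  shows "f t = f 0 + t *\<^sub>R a"
proof -
  have "((\<lambda>t. f t - t *\<^sub>R a) has_vector_derivative 0) (at t within I)" if "t \<in> I" for t
    by (auto intro!: derivative_eq_intros f that)
  then have "\<exists>c. \<forall>t\<in>I. f t - t *\<^sub>R a = c"
    by (intro has_derivative_zero_constant assms(1)) (simp add: has_vector_derivative_def)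
  then obtain c where "\<forall>t\<in>I. f t - t *\<^sub>R a = c" ..
  then have "f t - t *\<^sub>R a = f 0 - 0 *\<^sub>R a"
    using assms(2,3) by metis
  then show ?thesis
    by (simp add: algebra_simps)
qed

lemma has_vector_derivative_exp_comp:
  fixes f :: "real \<Rightarrow> complex"
  assumes "(f has_vector_derivative f') (at t within S)"
  shows "((\<lambda>t. exp (f t)) has_vector_derivative f' * exp (f t)) (at t within S)"
  using field_vector_diff_chain_within[OF assms DERIV_exp[THEN has_field_derivative_at_within]]
  by (simp add: o_def)

text \<open>The origin of the quadratic under the logarithm: it appears when moduli are taken in the
  formula for e^(-w/2).\<close>

lemma norm_one_minus_half_sq:
  "(cmod (1 - Complex U V / 2 * of_real t))\<^sup>2 = (U\<^sup>2 + V\<^sup>2) / 4 * t\<^sup>2 - U * t + 1"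
  unfolding cmod_power2 by (simp add: power2_eq_square field_simps)

section \<open>First integrals and the explicit form of a geodesic\<close>

text \<open>Both e^(-w/2) and z e^(w/2) are affine in \<open>t\<close>, and their product is z. The
  formula for w' is kept as well, since e^(-w/2) determines w only modulo 4 pi i.\<close>

lemma warren_forward_geodesic_solution:
  fixes z w :: "real \<Rightarrow> complex"
  assumes "forward_geodesic (associated_riemannian warren_metric)
             (vector [z0, w0]) (vector [Z, W]) I (\<lambda>t. vector [z t, w t])" and t: "t \<in> I"
  shows "exp (- w t / 2) = exp (- w0 / 2) * (1 - W / 2 * of_real t)"
    and "z t = (1 - W / 2 * of_real t) * (z0 + (Z + z0 * W / 2) * of_real t)"
    and "(w has_vector_derivative W / (1 - W / 2 * of_real t)) (at t within I)"
proof -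
  obtain vel where I: "forward_interval I" and init: "vector [z 0, w 0] = (vector [z0, w0] :: complex^2)"
    "vel 0 = vector [Z, W]"
    and geo: "geodesic_on (associated_riemannian warren_metric) I (\<lambda>t. vector [z t, w t]) vel"
    using assms(1) unfolding forward_geodesic_def by blast
  define z' w' where "z' = (\<lambda>t. vel t $ 1)" and "w' = (\<lambda>t. vel t $ 2)"
  have "z 0 = z0" "w 0 = w0"
    using arg_cong[OF init(1), of "\<lambda>x. x $ 1"] arg_cong[OF init(1), of "\<lambda>x. x $ 2"] by auto
  note [simp] = this
  have [simp]: "z' 0 = Z" "w' 0 = W"
    by (simp_all add: z'_def w'_def init)
  have conv: "convex I" and "0 \<in> I"
    using I by (auto simp: forward_interval_def is_interval_convex)
  note affine = has_vector_derivative_const_imp_affine[OF conv \<open>0 \<in> I\<close>]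
  have z: "(z has_vector_derivative z' t) (at t within I)"
    and w: "(w has_vector_derivative w' t) (at t within I)"
    and z'': "(z' has_vector_derivative - (z' t * w' t) - z t * (w' t)\<^sup>2 / 2) (at t within I)"
    and w'': "(w' has_vector_derivative (w' t)\<^sup>2 / 2) (at t within I)" if "t \<in> I" for t
    using geo that unfolding geodesic_on_warren_iff z'_def w'_def by auto
  have em: "((\<lambda>t. exp (- w t / 2)) has_vector_derivative - w' t / 2 * exp (- w t / 2)) (at t within I)"
    and ep: "((\<lambda>t. exp (w t / 2)) has_vector_derivative w' t / 2 * exp (w t / 2)) (at t within I)"
    if "t \<in> I" for t
    by (intro has_vector_derivative_exp_comp has_vector_derivative_divide
          has_vector_derivative_minus w that)+
  \<comment> \<open>This first integral is -2 times the derivative of e^(-w/2); its own derivative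
    is (w'' - w'^2/2) e^(-w/2) = 0.\<close>
  have w'c: "w' t * exp (- w t / 2) = W * exp (- w0 / 2)" if "t \<in> I" for t
  proof -
    have "((\<lambda>t. w' t * exp (- w t / 2)) has_vector_derivative 0) (at t within I)" if "t \<in> I" for t
      by (rule derivative_eq_intros em w'' that refl)+ (simp add: power2_eq_square)
    from affine[OF that this] show ?thesis
      by simp
  qed
  have e: "exp (- w t / 2) = exp (- w0 / 2) * (1 - W / 2 * of_real t)" if "t \<in> I" for t
  proof -
    have "((\<lambda>t. exp (- w t / 2)) has_vector_derivative - (W * exp (- w0 / 2)) / 2) (at t within I)"
      if "t \<in> I" for t
      using em[OF that] w'c[OF that] by simp
    from affine[OF that this] show ?thesis
      by (simp add: scaleR_conv_of_real algebra_simps)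
  qed
  then show "exp (- w t / 2) = exp (- w0 / 2) * (1 - W / 2 * of_real t)"
    using t .
  \<comment> \<open>An exponential never vanishes, so a geodesic cannot reach a zero of the linear
    factor.\<close>
  have nz: "1 - W / 2 * of_real t \<noteq> 0"
    using e[OF t] by (metis exp_not_eq_zero mult_zero_right)
  have "w' t * (1 - W / 2 * of_real t) = W"
    using w'c[OF t] unfolding e[OF t] by (simp add: mult.left_commute)
  then have "w' t = W / (1 - W / 2 * of_real t)"
    using nz by (metis nonzero_mult_div_cancel_right)
  then show "(w has_vector_derivative W / (1 - W / 2 * of_real t)) (at t within I)"
    using w[OF t] by simp
  \<comment> \<open>The derivative of z e^(w/2). Differentiating once more and inserting w'' =
    w'^2/2 gives (z'' + z'w' + z w'^2/2) e^(w/2), which is zero by the equation for z''.\<close>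
  have z'c: "(z' t + z t * w' t / 2) * exp (w t / 2) = (Z + z0 * W / 2) * exp (w0 / 2)"
    if "t \<in> I" for t
  proof -
    have "((\<lambda>t. (z' t + z t * w' t / 2) * exp (w t / 2)) has_vector_derivative 0) (at t within I)"
      if "t \<in> I" for t
      by (rule derivative_eq_intros ep z z'' w'' that refl)+ (simp add: power2_eq_square field_simps)
    from affine[OF that this] show ?thesis
      by simp
  qed
  have "((\<lambda>t. z t * exp (w t / 2)) has_vector_derivative (Z + z0 * W / 2) * exp (w0 / 2)) (at t within I)"
    if "t \<in> I" for t
    unfolding z'c[OF that, symmetric]
    by (rule derivative_eq_intros ep z that refl)+ (simp add: field_simps)
  from affine[OF t this]
  have "z t * exp (w t / 2) = exp (w0 / 2) * (z0 + (Z + z0 * W / 2) * of_real t)"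
    by (simp add: scaleR_conv_of_real algebra_simps)
  then have "z t * (exp (w t / 2) * exp (- w t / 2)) =
     (exp (w0 / 2) * exp (- w0 / 2)) * ((1 - W / 2 * of_real t) * (z0 + (Z + z0 * W / 2) * of_real t))"
    unfolding e[OF t] by (simp add: mult_ac)
  then show "z t = (1 - W / 2 * of_real t) * (z0 + (Z + z0 * W / 2) * of_real t)"
    by (simp add: exp_add[symmetric])
qed

text \<open>The squared modulus of e^(-w/2) is e^(-u), free of any branch ambiguity. Positivity of
  the quadratic is recorded because it later excludes the time 2/U.\<close>

lemma warren_forward_geodesic_Re:
  assumes "forward_geodesic (associated_riemannian warren_metric)
             (vector [z0, Complex u0 v0]) (vector [Z, Complex U V]) I (\<lambda>t. vector [z t, w t])"
    and "t \<in> I"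
  shows "(U\<^sup>2 + V\<^sup>2) / 4 * t\<^sup>2 - U * t + 1 > 0"
    and "Re (w t) = u0 - ln ((U\<^sup>2 + V\<^sup>2) / 4 * t\<^sup>2 - U * t + 1)"
proof -
  let ?q = "(U\<^sup>2 + V\<^sup>2) / 4 * t\<^sup>2 - U * t + 1"
  have "(cmod (exp (- w t / 2)))\<^sup>2 = (cmod (exp (- Complex u0 v0 / 2)))\<^sup>2 * ?q"
    unfolding warren_forward_geodesic_solution(1)[OF assms] norm_mult power_mult_distrib
      norm_one_minus_half_sq ..
  then have q: "exp (- Re (w t)) = exp (- u0) * ?q"
    by (simp add: exp_double[symmetric])
  then show "?q > 0"
    by (metis exp_gt_zero zero_less_mult_pos)
  then have "- Re (w t) = - u0 + ln ?q"
    using arg_cong[OF q, of ln] by (simp add: ln_mult)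
  then show "Re (w t) = u0 - ln ?q"
    by simp
qed

text \<open>Taking arguments in e^(-w/2) would fix v only modulo 4 pi. Instead v' = Im (W / (1 - W
  t/2)) = V / \<open>?q t\<close> is integrated from the initial value, and the arctan term is an
  antiderivative valid on all of \<open>I\<close>.\<close>

lemma warren_forward_geodesic_Im:
  assumes geo: "forward_geodesic (associated_riemannian warren_metric)
             (vector [z0, Complex u0 v0]) (vector [Z, Complex U V]) I (\<lambda>t. vector [z t, w t])"
    and t: "t \<in> I"
  shows "Im (w t) = (if V \<noteq> 0
            then v0 + 2 * arctan (U / V) - 2 * arctan ((U - (U\<^sup>2 + V\<^sup>2) / 2 * t) / V) else v0)"
proof -
  let ?q = "\<lambda>t. (U\<^sup>2 + V\<^sup>2) / 4 * t\<^sup>2 - U * t + 1"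
  have I: "convex I" "0 \<in> I"
    using geo by (auto simp: forward_geodesic_def forward_interval_def is_interval_convex)
  have "vector [z 0, w 0] = (vector [z0, Complex u0 v0] :: complex^2)"
    using geo by (simp add: forward_geodesic_def)
  from arg_cong[OF this, of "\<lambda>x. x $ 2"] have [simp]: "w 0 = Complex u0 v0"
    by simp
  have Im: "((\<lambda>t. Im (w t)) has_vector_derivative V / ?q t) (at t within I)" if "t \<in> I" for t
  proof -
    have "Im (Complex U V / (1 - Complex U V / 2 * of_real t)) = V / ?q t"
      unfolding Im_divide cmod_power2[symmetric] norm_one_minus_half_sq
      by (simp add: algebra_simps)
    then show ?thesis
      using bounded_linear.has_vector_derivative[OF bounded_linear_Im
          warren_forward_geodesic_solution(3)[OF geo that]]
      by simp
  qed
  show ?thesis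
  proof (cases "V = 0")
    case True
    with Im have "((\<lambda>t. Im (w t)) has_vector_derivative 0) (at t within I)" if "t \<in> I" for t
      using that by fastforce
    from has_vector_derivative_const_imp_affine[OF I t this] True show ?thesis
      by simp
  next
    case False
    let ?f = "\<lambda>t. 2 * arctan ((U - (U\<^sup>2 + V\<^sup>2) / 2 * t) / V)"
    have f: "(?f has_vector_derivative - (V / ?q t)) (at t within I)" if "t \<in> I" for t
    proof -
      have "?q t > 0"
        using warren_forward_geodesic_Re(1)[OF geo that] .
      have pos: "U\<^sup>2 + V\<^sup>2 > 0"
        using False by (simp add: sum_power2_gt_zero_iff)
      \<comment> \<open>Completing the square: V^2 + (U - |W|^2 t/2)^2 = |W|^2 \<open>?q t\<close>.
        This turns the derivative of arctan into a multiple of 1 / \<open>?q t\<close>.\<close>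
      have eq: "1 + ((U - (U\<^sup>2 + V\<^sup>2) / 2 * t) / V)\<^sup>2 = (U\<^sup>2 + V\<^sup>2) * ?q t / V\<^sup>2"
        using False by (simp add: field_simps power2_eq_square)
      have "((\<lambda>t. (U - (U\<^sup>2 + V\<^sup>2) / 2 * t) / V) has_field_derivative
          - ((U\<^sup>2 + V\<^sup>2) / 2) / V) (at t within I)"
        using False by (auto intro!: derivative_eq_intros simp: field_simps)
      from DERIV_cmult[OF DERIV_chain2[OF DERIV_arctan this], of 2]
      have "(?f has_field_derivative
          2 * (inverse (1 + ((U - (U\<^sup>2 + V\<^sup>2) / 2 * t) / V)\<^sup>2) * (- ((U\<^sup>2 + V\<^sup>2) / 2) / V))) (at t within I)" .
      also have "2 * (inverse (1 + ((U - (U\<^sup>2 + V\<^sup>2) / 2 * t) / V)\<^sup>2) * (- ((U\<^sup>2 + V\<^sup>2) / 2) / V)) =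
          - (V / ?q t)"
        unfolding eq using \<open>?q t > 0\<close> pos False by (simp add: divide_simps power2_eq_square)
      finally show ?thesis
        by (simp add: has_real_derivative_iff_has_vector_derivative)
    qed
    have "((\<lambda>t. Im (w t) + ?f t) has_vector_derivative 0) (at t within I)" if "t \<in> I" for t
      by (rule has_vector_derivative_eq_rhs[OF has_vector_derivative_add[OF Im f]]) (use that in simp_all)
    from has_vector_derivative_const_imp_affine[OF I t this] False show ?thesis
      by simp
  qed
qed

section \<open>Uniqueness, existence and maximal extension of geodesics\<close>

text \<open>The formulas for z, u and v involve only the initial data and \<open>t\<close>, so they
  take the place of a uniqueness theorem for differential equations.\<close>

lemma warren_forward_geodesic_unique:
  assumes "forward_geodesic (associated_riemannian warren_metric)
             (vector [z0, w0]) (vector [Z, W]) I (\<lambda>t. vector [z t, w t])"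
    and "forward_geodesic (associated_riemannian warren_metric)
             (vector [z0, w0]) (vector [Z, W]) J (\<lambda>t. vector [x t, y t])"
    and "t \<in> I" "t \<in> J"
  shows "x t = z t" "y t = w t"
proof -
  obtain u0 v0 U V where w0: "w0 = Complex u0 v0" and W: "W = Complex U V"
    by (meson complex.exhaust)
  note geo = assms(1,2)[unfolded w0 W]
  show "x t = z t"
    using warren_forward_geodesic_solution(2)[OF assms(1,3)]
      warren_forward_geodesic_solution(2)[OF assms(2,4)] by simp
  show "y t = w t"
    by (rule complex_eqI)
       (simp_all only: warren_forward_geodesic_Re(2)[OF geo(1) assms(3)]
          warren_forward_geodesic_Re(2)[OF geo(2) assms(4)]
          warren_forward_geodesic_Im[OF geo(1) assms(3)]
          warren_forward_geodesic_Im[OF geo(2) assms(4)])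
qed

lemma forward_intervalI:
  "is_interval I \<Longrightarrow> I \<subseteq> {0..} \<Longrightarrow> 0 \<in> I \<Longrightarrow> x \<in> I \<Longrightarrow> x \<noteq> 0 \<Longrightarrow> forward_interval I"
  by (auto simp: forward_interval_def)

text \<open>Off the slit the principal branch \<open>Ln\<close> is holomorphic, so w = w0 - 2
  \<open>Ln\<close> (1 - W t/2) inverts the formula for e^(-w/2), with the right initial value since
  \<open>Ln\<close> 1 = 0.\<close>

lemma warren_forward_geodesic_exists:
  assumes J: "forward_interval J"
    and slit: "\<And>t. t \<in> J \<Longrightarrow> 1 - W / 2 * of_real t \<notin> \<real>\<^sub>\<le>\<^sub>0"
  shows "forward_geodesic (associated_riemannian warren_metric) (vector [z0, w0]) (vector [Z, W]) J
           (\<lambda>t. vector [(1 - W / 2 * of_real t) * (z0 + (Z + z0 * W / 2) * of_real t),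
                        w0 - 2 * Ln (1 - W / 2 * of_real t)])"
proof -
  define vel :: "real \<Rightarrow> complex^2" where
    "vel t = vector [Z - W * (Z + z0 * W / 2) * of_real t, W / (1 - W / 2 * of_real t)]" for t
  have of_real': "(complex_of_real has_vector_derivative 1) (at t within J)" for t
    using bounded_linear.has_vector_derivative[OF bounded_linear_of_real has_vector_derivative_id] by simp
  have nz: "1 - W / 2 * of_real t \<noteq> 0" if "t \<in> J" for t
    using slit[OF that] by auto
  \<comment> \<open>The candidate and its velocity are restrictions to the real axis of holomorphic
    functions, so the geodesic equation can be checked by complex differentiation.\<close>
  have fd: "((\<lambda>t. f (complex_of_real t)) has_vector_derivative f') (at t within J)"
    if "(f has_field_derivative f') (at (of_real t))" for f f' t
    using field_vector_diff_chain_within[OF of_real' has_field_derivative_at_within[OF that]]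
    by (simp add: o_def)
  show ?thesis
    unfolding forward_geodesic_def
  proof (intro conjI exI[of _ vel])
    show "geodesic_on (associated_riemannian warren_metric) J
           (\<lambda>t. vector [(1 - W / 2 * of_real t) * (z0 + (Z + z0 * W / 2) * of_real t),
                        w0 - 2 * Ln (1 - W / 2 * of_real t)]) vel"
      unfolding geodesic_on_warren_iff vel_def vector_2
    proof (intro ballI conjI fd)
      fix t assume t: "t \<in> J"
      note nz = nz[OF t] and sl = slit[OF t]
      show "((\<lambda>s. (1 - W / 2 * s) * (z0 + (Z + z0 * W / 2) * s)) has_field_derivative
              Z - W * (Z + z0 * W / 2) * of_real t) (at (of_real t))"
        by (auto intro!: derivative_eq_intros simp: field_simps)
      show "((\<lambda>s. w0 - 2 * Ln (1 - W / 2 * s)) has_field_derivative W / (1 - W / 2 * of_real t))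
              (at (of_real t))"
        by (rule derivative_eq_intros sl refl)+ (use nz in \<open>simp_all add: field_simps\<close>)
      show "((\<lambda>s. Z - W * (Z + z0 * W / 2) * s) has_field_derivative
          - ((Z - W * (Z + z0 * W / 2) * of_real t) * (W / (1 - W / 2 * of_real t)))
          - (1 - W / 2 * of_real t) * (z0 + (Z + z0 * W / 2) * of_real t) *
            (W / (1 - W / 2 * of_real t))\<^sup>2 / 2) (at (of_real t))"
      proof -
        define r where "r = 1 - W / 2 * of_real t"
        have "r \<noteq> 0" using nz by (simp add: r_def)
        \<comment> \<open>Since z is quadratic in \<open>t\<close>, the right side of its equation
          must reduce to the constant second derivative -W (Z + z0 W/2).\<close>
        have eq: "- ((Z - W * (Z + z0 * W / 2) * of_real t) * (W / r))
          - r * (z0 + (Z + z0 * W / 2) * of_real t) * (W / r)\<^sup>2 / 2 = - (W * (Z + z0 * W / 2)) * r / r"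
          unfolding power2_eq_square using \<open>r \<noteq> 0\<close>
          by (simp add: divide_simps) (simp add: r_def algebra_simps)
        show ?thesis
          unfolding r_def[symmetric] eq using \<open>r \<noteq> 0\<close>
          by (auto intro!: derivative_eq_intros)
      qed
      show "((\<lambda>s. W / (1 - W / 2 * s)) has_field_derivative (W / (1 - W / 2 * of_real t))\<^sup>2 / 2)
              (at (of_real t))"
        by (rule derivative_eq_intros nz refl)+ (use nz in \<open>simp add: power2_eq_square\<close>)
    qed
  qed (use J in \<open>simp_all add: vel_def\<close>)
qed

text \<open>The explicit solution on \<open>J\<close> agrees on \<open>I\<close> with the given
  geodesic by uniqueness. It is thus an extension of it, and maximality forces equality of the
  intervals.\<close>

lemma warren_maximal_forward_geodesic_interval:
  assumes max: "maximal_forward_geodesic (associated_riemannian warren_metric)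
                   (vector [z0, w0]) (vector [Z, W]) I (\<lambda>t. vector [z t, w t])"
    and J: "forward_interval J" "I \<subseteq> J" "\<And>t. t \<in> J \<Longrightarrow> 1 - W / 2 * of_real t \<notin> \<real>\<^sub>\<le>\<^sub>0"
  shows "I = J"
proof -
  have geo: "forward_geodesic (associated_riemannian warren_metric)
               (vector [z0, w0]) (vector [Z, W]) I (\<lambda>t. vector [z t, w t])"
    using max by (simp add: maximal_forward_geodesic_def)
  note ext = warren_forward_geodesic_exists[OF J(1,3), of z0 w0 Z]
  show ?thesis
    using max ext warren_forward_geodesic_unique[OF geo ext] J(2)
    unfolding maximal_forward_geodesic_def by (smt (verit, best) subsetD)
qed

section \<open>Explicit formulas, interval of existence and blow-up\<close>

theorem mainTheorem2:
  fixes z w :: "real \<Rightarrow> complex" and z0 w0 Z W :: complex and u0 v0 U V :: real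
    and I :: "real set"
  assumes geod: "maximal_forward_geodesic (associated_riemannian warren_metric)
                   (vector [z0, w0]) (vector [Z, W]) I (\<lambda>t. vector [z t, w t])"
    and w0: "w0 = Complex u0 v0" and W: "W = Complex U V"
  shows "(\<forall>t\<in>I.
            Re (w t) = u0 - ln ((U\<^sup>2 + V\<^sup>2) / 4 * t\<^sup>2 - U * t + 1) \<and>
            Im (w t) = (if V \<noteq> 0
                        then v0 + 2 * arctan (U / V)
                               - 2 * arctan ((U - (U\<^sup>2 + V\<^sup>2) / 2 * t) / V)
                        else v0) \<and>
            z t = (1 - W / 2 * of_real t) * (z0 + (Z + z0 * W / 2) * of_real t)) \<and>
         (U \<le> 0 \<or> V \<noteq> 0 \<longrightarrow> I = {0..}) \<and>
         (U > 0 \<and> V = 0 \<longrightarrow>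
            I = {0..<2 / U} \<and> filterlim (\<lambda>t. Re (w t)) at_top (at_left (2 / U)))"
proof (intro conjI ballI impI)
  have geo: "forward_geodesic (associated_riemannian warren_metric)
               (vector [z0, Complex u0 v0]) (vector [Z, Complex U V]) I (\<lambda>t. vector [z t, w t])"
    using geod by (simp add: maximal_forward_geodesic_def w0 W)
  fix t assume t: "t \<in> I"
  show "Re (w t) = u0 - ln ((U\<^sup>2 + V\<^sup>2) / 4 * t\<^sup>2 - U * t + 1)"
    using warren_forward_geodesic_Re(2)[OF geo t] .
  show "Im (w t) = (if V \<noteq> 0 then v0 + 2 * arctan (U / V)
      - 2 * arctan ((U - (U\<^sup>2 + V\<^sup>2) / 2 * t) / V) else v0)"
    using warren_forward_geodesic_Im[OF geo t] .
  show "z t = (1 - W / 2 * of_real t) * (z0 + (Z + z0 * W / 2) * of_real t)"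
    using warren_forward_geodesic_solution(2)[OF geo t] W by simp
next
  assume UV: "U \<le> 0 \<or> V \<noteq> 0"
  have I: "I \<subseteq> {0..}"
    using geod by (auto simp: maximal_forward_geodesic_def forward_geodesic_def forward_interval_def)
  \<comment> \<open>The imaginary part -V t/2 is nonzero unless V = 0 or t = 0; in those two cases U
    t is nonpositive, so the real part 1 - U t/2 is at least 1.\<close>
  have "1 - W / 2 * of_real t \<notin> \<real>\<^sub>\<le>\<^sub>0" if "t \<in> {0..}" for t
  proof (cases "V = 0 \<or> t = 0")
    case True
    then have "U * t \<le> 0"
      using UV that by (auto simp: mult_nonpos_nonneg)
    then show ?thesis
      by (simp add: complex_nonpos_Reals_iff W)
  next
    case False
    then show ?thesis
      by (simp add: complex_nonpos_Reals_iff W)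
  qed
  moreover have "forward_interval {0..}"
    by (rule forward_intervalI[where x = 1]) (auto simp: is_interval_ci)
  ultimately show "I = {0..}"
    using warren_maximal_forward_geodesic_interval[OF geod _ I] by blast
next
  assume "U > 0 \<and> V = 0"
  then have U: "U > 0" and V: "V = 0"
    by auto
  have geo: "forward_geodesic (associated_riemannian warren_metric)
               (vector [z0, Complex u0 v0]) (vector [Z, Complex U V]) I (\<lambda>t. vector [z t, w t])"
    using geod by (simp add: maximal_forward_geodesic_def w0 W)
  have I: "is_interval I" "I \<subseteq> {0..}" "0 \<in> I"
    using geo by (auto simp: forward_geodesic_def forward_interval_def)
  \<comment> \<open>For V = 0 the quadratic is (1 - U t/2)^2, which vanishes at 2/U, against its
    positivity on \<open>I\<close>. An interval starting at 0 that misses this point lies entirely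
    before it.\<close>
  have "2 / U \<notin> I"
    using warren_forward_geodesic_Re(1)[OF geo, of "2 / U"] U V
    by (auto simp: power2_eq_square field_simps)
  then have "I \<subseteq> {0..<2 / U}"
    using I U unfolding is_interval_1 by (smt (verit, ccfv_SIG) atLeastLessThan_iff atLeast_iff
      divide_pos_pos subset_iff)
  moreover have "forward_interval {0..<2 / U}"
    using U by (intro forward_intervalI[where x = "1 / U"]) (auto simp: is_interval_co divide_strict_right_mono)
  moreover have "1 - W / 2 * of_real t \<notin> \<real>\<^sub>\<le>\<^sub>0" if "t \<in> {0..<2 / U}" for t
    using that U by (auto simp: complex_nonpos_Reals_iff W V field_simps)
  ultimately show I_eq: "I = {0..<2 / U}"
    using warren_maximal_forward_geodesic_interval[OF geod] by blast
  have "((\<lambda>t. (1 - U / 2 * t)\<^sup>2) \<longlongrightarrow> 0) (at_left (2 / U))"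
    using U by (auto intro!: tendsto_eq_intros)
  \<comment> \<open>Staying strictly left of 2/U serves twice: the square approaches 0 through
    positive values, as the limit of \<open>ln\<close> at 0 requires, and \<open>t\<close> lies in
    \<open>I\<close>, where the formula for u holds.\<close>
  moreover have ev: "eventually (\<lambda>t. t \<in> {0<..<2 / U}) (at_left (2 / U))"
    using U by (intro eventually_at_leftI) auto
  then have "eventually (\<lambda>t. (1 - U / 2 * t)\<^sup>2 > 0) (at_left (2 / U))"
    by eventually_elim (use U in \<open>auto simp: field_simps\<close>)
  ultimately have "filterlim (\<lambda>t. (1 - U / 2 * t)\<^sup>2) (at_right 0) (at_left (2 / U))"
    by (auto simp: filterlim_at elim: eventually_mono)
  then have "filterlim (\<lambda>t. - ln ((1 - U / 2 * t)\<^sup>2)) at_top (at_left (2 / U))"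
    unfolding filterlim_uminus_at_top minus_minus by (rule filterlim_compose[OF ln_at_0])
  then have "filterlim (\<lambda>t. u0 + - ln ((1 - U / 2 * t)\<^sup>2)) at_top (at_left (2 / U))"
    by (rule filterlim_tendsto_add_at_top[OF tendsto_const])
  moreover have "eventually (\<lambda>t. u0 + - ln ((1 - U / 2 * t)\<^sup>2) = Re (w t)) (at_left (2 / U))"
    using ev
  proof eventually_elim
    case (elim t)
    then have "t \<in> I"
      by (simp add: I_eq)
    from warren_forward_geodesic_Re(2)[OF geo this] V show ?case
      by (simp add: power2_eq_square field_simps)
  qed
  ultimately show "filterlim (\<lambda>t. Re (w t)) at_top (at_left (2 / U))"
    by (simp add: filterlim_cong)
qed

end
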